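(* Let $\kappa<0$, $0<\alpha<1$, $T>0$, let $N\ge 1$ be an integer, $\tau=T/N$, $t_n=n\tau$ and $t_{n-\frac12}=(n-\frac12)\tau$. Let $u$ be the solution of $u'(t)=\kappa u(t)+f(t)$, $0<t\le T$, $u(0)=u_0$, and suppose that $u$ satisfies the regularity bound $|u^{(k)}(t)|\le M\,t^{\alpha-k}$ for $k=1,2,3$ and $0<t\le T$, with some constant $M$. Let $U^n$ be given by the Crank–Nicolson scheme $$\frac{U^n-U^{n-1}}{\tau}=\kappa\,\frac{U^n+U^{n-1}}{2}+f(t_{n-\frac12}),\quad 1\le n\le N,\qquad U^0=u_0,$$ and let $e^n=u(t_n)-U^n$. Then there is a constant $C_{u,\alpha}>0$ depending only on $\alpha$ and $M$ such that, whenever $0<-\kappa\tau<1$, for all $1\le n\le N$, $$|e^n|\le e^{\kappa t_n}|e^{0}|+C_{u,\alpha}\Big(C_3e^{\kappa t_n/2}\tau^\alpha+C_4\,t_n^{\alpha-2}\tau^2\Big),$$ where $C_3:=\frac{9}{2-\alpha}+12e^{\kappa t_n/2}$ and $$C_4:=\begin{cases}\frac{1}{2-\alpha}\big(2^{2-\alpha}(1-e^{7\kappa t_n/12})-1\big), & t_n>\frac{12}{7\kappa}\ln(1-2^{\alpha-2}),\\ 0,& t_n\le \frac{12}{7\kappa}\ln(1-2^{\alpha-2}).\end{cases}$$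
   Context: The solution $u$ is real-valued, continuous on $[0,T]$ and three times continuously differentiable on $(0,T]$, with a possible weak singularity at $t=0$; $f$ is the corresponding given source term on $(0,T]$. The constant $C_{u,\alpha}$ is independent of $n$, $N$, $\tau$, $T$ and $\kappa$. *)

theory Defs
  imports "HOL-Analysis.Analysis"
begin

text \<open>
  Derivatives are taken relative to \<open>S\<close>; for \<open>S = {0<..T}\<close> this is the ordinary derivative on
  \<open>(0, T)\<close> and the left derivative at \<open>T\<close>, so nothing is required of the functions beyond \<open>T\<close>.
\<close>

primrec deriv_on :: "nat \<Rightarrow> real set \<Rightarrow> (real \<Rightarrow> real) \<Rightarrow> real \<Rightarrow> real" where
  "deriv_on 0 S u = u"
| "deriv_on (Suc k) S u = (\<lambda>t. vector_derivative (deriv_on k S u) (at t within S))"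

definition Ck_on :: "nat \<Rightarrow> real set \<Rightarrow> (real \<Rightarrow> real) \<Rightarrow> bool" where
  "Ck_on k S u \<longleftrightarrow>
     (\<forall>j<k. deriv_on j S u differentiable_on S) \<and> continuous_on S (deriv_on k S u)"

definition solves_ivp ::
    "real \<Rightarrow> (real \<Rightarrow> real) \<Rightarrow> real \<Rightarrow> real \<Rightarrow> (real \<Rightarrow> real) \<Rightarrow> bool" where
  "solves_ivp \<kappa> f u0 T u \<longleftrightarrow>
     continuous_on {0..T} u \<and> Ck_on 3 {0<..T} u \<and> u 0 = u0 \<and>
     (\<forall>t\<in>{0<..T}. deriv_on 1 {0<..T} u t = \<kappa> * u t + f t)"

definition weakly_singular_bound ::
    "real \<Rightarrow> real \<Rightarrow> real \<Rightarrow> (real \<Rightarrow> real) \<Rightarrow> bool" where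
  "weakly_singular_bound \<alpha> M T u \<longleftrightarrow>
     (\<forall>k\<in>{1,2,3}. \<forall>t\<in>{0<..T}. \<bar>deriv_on k {0<..T} u t\<bar> \<le> M * t powr (\<alpha> - real k))"

definition crank_nicolson ::
    "real \<Rightarrow> (real \<Rightarrow> real) \<Rightarrow> real \<Rightarrow> real \<Rightarrow> nat \<Rightarrow> (nat \<Rightarrow> real) \<Rightarrow> bool" where
  "crank_nicolson \<kappa> f u0 \<tau> N U \<longleftrightarrow>
     U 0 = u0 \<and>
     (\<forall>n\<in>{1..N}. (U n - U (n - 1)) / \<tau> =
        \<kappa> * ((U n + U (n - 1)) / 2) + f ((real n - 1/2) * \<tau>))"

definition C3 :: "real \<Rightarrow> real \<Rightarrow> real \<Rightarrow> real" where
  "C3 \<alpha> \<kappa> t = 9 / (2 - \<alpha>) + 12 * exp (\<kappa> * t / 2)"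

definition C4 :: "real \<Rightarrow> real \<Rightarrow> real \<Rightarrow> real" where
  "C4 \<alpha> \<kappa> t =
     (if t > 12 / (7 * \<kappa>) * ln (1 - 2 powr (\<alpha> - 2))
      then 1 / (2 - \<alpha>) * (2 powr (2 - \<alpha>) * (1 - exp (7 * \<kappa> * t / 12)) - 1)
      else 0)"

end

theory Submission
  imports Defs
begin

text \<open>
  With \<open>z = - \<kappa> * \<tau>\<close>, one Crank--Nicolson step multiplies the error by at most
  \<open>(1 - z/2) / (1 + z/2) \<le> exp (- z)\<close> and adds a local defect of size
  \<open>\<tau> powr \<alpha> * (j powr (\<alpha> - 3) + z * j powr (\<alpha> - 2))\<close>. In the resulting convolution sum, the
  indices \<open>j \<le> n/2\<close> are damped by \<open>exp (\<kappa> * t n / 2)\<close> and their defects are summable, while for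
  \<open>j > n/2\<close> the singular factors are comparable to their value at \<open>n\<close> and the geometric series
  absorbs the factor \<open>z\<close>. The second part is controlled by \<open>C4\<close> once \<open>C4\<close> is bounded below; otherwise
  \<open>exp (\<kappa> * t n / 2)\<close> is bounded below and the first term of the bound covers everything.
\<close>

section \<open>Taylor estimates around the midpoint of a cell\<close>

lemma Ck_on_has_real_derivative:
  assumes "Ck_on m S u" "j < m" "x \<in> S"
  shows "(deriv_on j S u has_real_derivative deriv_on (Suc j) S u x) (at x within S)"
  using assms
  by (auto simp: Ck_on_def differentiable_on_def vector_derivative_works
      has_real_derivative_iff_has_vector_derivative)

text \<open>The mean value inequality is applied three times: to \<open>u''\<close>, then to the
  first-order Taylor remainder \<open>g\<close> of \<open>u'\<close> at the midpoint, then to the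
  second-order Taylor remainder \<open>w\<close> of \<open>u\<close>. Estimating every distance to
  the midpoint by \<open>b - a\<close> gives the constant 1 rather than the sharp 1/24, which
  suffices because only the order matters later.\<close>

lemma midpoint_slope_error:
  fixes u u' u'' u''' :: "real \<Rightarrow> real"
  assumes ab: "a \<le> b"
    and d1: "\<And>x. x \<in> {a..b} \<Longrightarrow> (u has_real_derivative u' x) (at x within {a..b})"
    and d2: "\<And>x. x \<in> {a..b} \<Longrightarrow> (u' has_real_derivative u'' x) (at x within {a..b})"
    and d3: "\<And>x. x \<in> {a..b} \<Longrightarrow> (u'' has_real_derivative u''' x) (at x within {a..b})"
    and B: "\<And>x. x \<in> {a..b} \<Longrightarrow> \<bar>u''' x\<bar> \<le> B"
  shows "\<bar>u b - u a - (b - a) * u' ((a + b) / 2)\<bar> \<le> B * (b - a) ^ 3"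
proof -
  define m where "m = (a + b) / 2"
  have m: "m \<in> {a..b}" using ab by (auto simp: m_def)
  have B0: "B \<ge> 0" using B[OF m] by linarith
  have dist_m: "\<bar>x - m\<bar> \<le> b - a" if "x \<in> {a..b}" for x
    using that ab by (auto simp: m_def abs_le_iff field_simps)
  have 1: "\<bar>u'' x - u'' m\<bar> \<le> B * (b - a)" if x: "x \<in> {a..b}" for x
  proof -
    have "norm (u'' x - u'' m) \<le> B * norm (x - m)"
      by (rule field_differentiable_bound[OF convex_real_interval(5) d3]) (use B x m in auto)
    also have "\<dots> \<le> B * (b - a)" using dist_m[OF x] B0 by (simp add: mult_left_mono)
    finally show ?thesis by simp
  qed
  define g where "g = (\<lambda>x. u' x - u' m - (x - m) * u'' m)"
  have dg: "(g has_real_derivative (u'' x - u'' m)) (at x within {a..b})" if "x \<in> {a..b}" for x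
    unfolding g_def using d2[OF that] by (auto intro!: derivative_eq_intros)
  have 2: "\<bar>g x\<bar> \<le> B * (b - a)\<^sup>2" if x: "x \<in> {a..b}" for x
  proof -
    have "norm (g x - g m) \<le> (B * (b - a)) * norm (x - m)"
      by (rule field_differentiable_bound[OF convex_real_interval(5) dg]) (use 1 x m in auto)
    also have "\<dots> \<le> (B * (b - a)) * (b - a)" using dist_m[OF x] B0 ab by (simp add: mult_left_mono)
    finally show ?thesis by (simp add: g_def power2_eq_square mult.assoc)
  qed
  define w where "w = (\<lambda>x. u x - (x - m) * u' m - (x - m)\<^sup>2 / 2 * u'' m)"
  have dw: "(w has_real_derivative g x) (at x within {a..b})" if "x \<in> {a..b}" for x
    unfolding w_def g_def using d1[OF that] by (auto intro!: derivative_eq_intros)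
  have "norm (w b - w a) \<le> (B * (b - a)\<^sup>2) * norm (b - a)"
    by (rule field_differentiable_bound[OF convex_real_interval(5) dw]) (use 2 ab in auto)
  \<comment> \<open>The endpoints are symmetric about \<open>m\<close>, so the quadratic terms of
    the remainder cancel; this is where the third order comes from.\<close>
  moreover have "w b - w a = u b - u a - (b - a) * u' m"
    by (simp add: w_def m_def field_simps power2_eq_square)
  ultimately show ?thesis using ab by (simp add: m_def power3_eq_cube power2_eq_square mult.assoc)
qed

text \<open>The same argument one order lower: in the average of the endpoint values the linear
  Taylor terms at the midpoint cancel, so only the first-order remainder \<open>v\<close> is
  left.\<close>

lemma midpoint_average_error:
  fixes u u' u'' :: "real \<Rightarrow> real"
  assumes ab: "a \<le> b"
    and d1: "\<And>x. x \<in> {a..b} \<Longrightarrow> (u has_real_derivative u' x) (at x within {a..b})"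
    and d2: "\<And>x. x \<in> {a..b} \<Longrightarrow> (u' has_real_derivative u'' x) (at x within {a..b})"
    and B: "\<And>x. x \<in> {a..b} \<Longrightarrow> \<bar>u'' x\<bar> \<le> B"
  shows "\<bar>(u a + u b) / 2 - u ((a + b) / 2)\<bar> \<le> B * (b - a)\<^sup>2"
proof -
  define m where "m = (a + b) / 2"
  have m: "m \<in> {a..b}" using ab by (auto simp: m_def)
  have B0: "B \<ge> 0" using B[OF m] by linarith
  have dist_m: "\<bar>x - m\<bar> \<le> b - a" if "x \<in> {a..b}" for x
    using that ab by (auto simp: m_def abs_le_iff field_simps)
  have 1: "\<bar>u' x - u' m\<bar> \<le> B * (b - a)" if x: "x \<in> {a..b}" for x
  proof -
    have "norm (u' x - u' m) \<le> B * norm (x - m)"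
      by (rule field_differentiable_bound[OF convex_real_interval(5) d2]) (use B x m in auto)
    also have "\<dots> \<le> B * (b - a)" using dist_m[OF x] B0 by (simp add: mult_left_mono)
    finally show ?thesis by simp
  qed
  define v where "v = (\<lambda>x. u x - u m - (x - m) * u' m)"
  have dv: "(v has_real_derivative (u' x - u' m)) (at x within {a..b})" if "x \<in> {a..b}" for x
    unfolding v_def using d1[OF that] by (auto intro!: derivative_eq_intros)
  have 2: "\<bar>v x\<bar> \<le> B * (b - a)\<^sup>2" if x: "x \<in> {a..b}" for x
  proof -
    have "norm (v x - v m) \<le> (B * (b - a)) * norm (x - m)"
      by (rule field_differentiable_bound[OF convex_real_interval(5) dv]) (use 1 x m in auto)
    also have "\<dots> \<le> (B * (b - a)) * (b - a)" using dist_m[OF x] B0 ab by (simp add: mult_left_mono)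
    finally show ?thesis by (simp add: v_def power2_eq_square mult.assoc)
  qed
  have "(u a + u b) / 2 - u m = (v a + v b) / 2"
    by (simp add: v_def m_def field_simps)
  moreover have "\<bar>v a\<bar> \<le> B * (b - a)\<^sup>2" "\<bar>v b\<bar> \<le> B * (b - a)\<^sup>2" using 2 ab by auto
  ultimately show ?thesis unfolding m_def[symmetric] abs_le_iff by (simp add: field_simps)
qed

section \<open>Local defect in the presence of the singularity at 0\<close>

text \<open>\<open>M / \<alpha> * t powr \<alpha>\<close> is an antiderivative of the bound on
  \<open>u'\<close>, so adding it to \<open>u\<close> or to \<open>- u\<close> gives a nondecreasing
  function. The derivative is used only on the open interval; continuity carries the estimate to the
  singular endpoint 0.\<close>

lemma increment_bound_powr:
  fixes u u' :: "real \<Rightarrow> real"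
  assumes "\<alpha> > 0" "0 \<le> x"
    and cont: "continuous_on {0..x} u"
    and d: "\<And>t. 0 < t \<Longrightarrow> t < x \<Longrightarrow> (u has_real_derivative u' t) (at t)"
    and B: "\<And>t. 0 < t \<Longrightarrow> t < x \<Longrightarrow> \<bar>u' t\<bar> \<le> M * t powr (\<alpha> - 1)"
  shows "\<bar>u x - u 0\<bar> \<le> M / \<alpha> * x powr \<alpha>"
proof -
  have c: "continuous_on {0..x} (\<lambda>t. M / \<alpha> * t powr \<alpha>)"
    using \<open>\<alpha> > 0\<close> by (intro continuous_on_mult continuous_on_powr' continuous_intros) auto
  have dp: "((\<lambda>t. M / \<alpha> * t powr \<alpha>) has_real_derivative M * t powr (\<alpha> - 1)) (at t)"
    if "0 < t" for t
    using that \<open>\<alpha> > 0\<close> by (auto intro!: derivative_eq_intros)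
  have "M / \<alpha> * 0 powr \<alpha> + s * u 0 \<le> M / \<alpha> * x powr \<alpha> + s * u x" if "s = 1 \<or> s = -1" for s
  proof (rule DERIV_nonneg_imp_increasing_open[where f = "\<lambda>t. M / \<alpha> * t powr \<alpha> + s * u t"])
    show "continuous_on {0..x} (\<lambda>t. M / \<alpha> * t powr \<alpha> + s * u t)"
      by (intro continuous_on_add c continuous_on_mult continuous_on_const cont)
    fix t assume t: "0 < t" "t < x"
    show "\<exists>y. ((\<lambda>t. M / \<alpha> * t powr \<alpha> + s * u t) has_real_derivative y) (at t) \<and> 0 \<le> y"
      using DERIV_add[OF dp[OF t(1)] DERIV_cmult[OF d[OF t], of s]] B[OF t] that
      by (intro exI[of _ "M * t powr (\<alpha> - 1) + s * u' t"]) auto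
  qed (use assms in auto)
  from this[of 1] this[of "-1"] show ?thesis by (auto simp: abs_le_iff)
qed

text \<open>Lets a singular weight at any point beyond \<open>t / 2\<close> be replaced by its value
  at \<open>t\<close>. It serves both the cells away from 0 and the late indices of the convolution
  sum.\<close>

lemma powr_neg_half_le:
  assumes "0 < t" "t \<le> 2 * s" "(p::real) \<le> 0"
  shows "s powr p \<le> 2 powr (- p) * t powr p"
proof -
  have "s powr p \<le> (t / 2) powr p" using assms by (intro powr_mono2') auto
  also have "\<dots> = 2 powr (- p) * t powr p"
    using assms by (simp add: powr_divide powr_minus field_simps)
  finally show ?thesis .
qed

lemma local_defect_bound:
  fixes u :: "real \<Rightarrow> real"
  assumes \<alpha>: "0 < \<alpha>" "\<alpha> < 1" and \<tau>: "0 < \<tau>" and \<kappa>: "\<kappa> < 0" and z1: "- \<kappa> * \<tau> < 1"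
    and j: "1 \<le> j" "real j * \<tau> \<le> T"
    and cont: "continuous_on {0..T} u"
    and Ck: "Ck_on 3 {0<..T} u"
    and bound: "weakly_singular_bound \<alpha> M T u"
  defines "a \<equiv> (real j - 1) * \<tau>" and "b \<equiv> real j * \<tau>" and "m \<equiv> (real j - 1/2) * \<tau>"
  shows "\<bar>u b - u a - \<tau> * deriv_on 1 {0<..T} u m - \<kappa> * \<tau> * ((u a + u b) / 2 - u m)\<bar>
    \<le> \<bar>M\<bar> * (8 + 2 / \<alpha>) * \<tau> powr \<alpha> * (real j powr (\<alpha> - 3) + (- \<kappa> * \<tau>) * real j powr (\<alpha> - 2))"
proof -
  define z where "z = - \<kappa> * \<tau>"
  have z: "0 < z" "z < 1" using \<tau> \<kappa> z1 by (auto simp: z_def mult_neg_pos)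
  define D where "D = (\<lambda>k. deriv_on k {0<..T} u)"
  have D0: "D 0 = u" by (simp add: D_def)
  have der: "(D k has_real_derivative D (Suc k) x) (at x within {0<..T})"
    if "k < 3" "x \<in> {0<..T}" for k x
    unfolding D_def by (rule Ck_on_has_real_derivative[OF Ck that])
  have DB: "\<bar>D k x\<bar> \<le> M * x powr (\<alpha> - real k)" if "k \<in> {1,2,3}" "x \<in> {0<..T}" for k x
    using bound that unfolding weakly_singular_bound_def D_def by blast
  have bT: "0 < b" "b \<le> T" using j \<tau> by (auto simp: b_def)
  have M: "M \<ge> 0"
  proof -
    have "0 \<le> M * b powr (\<alpha> - 1)" using DB[of 1 b] bT by (auto intro: order_trans[OF abs_ge_zero])
    then show ?thesis using bT by (simp add: zero_le_mult_iff)
  qed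
  have ab: "a \<le> b" "b - a = \<tau>" "(a + b) / 2 = m"
    using \<tau> by (auto simp: a_def b_def m_def field_simps)
  let ?P = "\<lambda>p. \<tau> powr \<alpha> * real j powr p"
  have "\<bar>u b - u a - \<tau> * D 1 m\<bar> \<le> M * (8 + 2 / \<alpha>) * ?P (\<alpha> - 3) \<and>
        \<bar>(u a + u b) / 2 - u m\<bar> \<le> M * (8 + 2 / \<alpha>) * ?P (\<alpha> - 2)"
  proof (cases "j = 1")
    case True
    have inc: "\<bar>u x - u 0\<bar> \<le> M / \<alpha> * x powr \<alpha>" if "0 \<le> x" "x \<le> b" for x
    proof (rule increment_bound_powr[where u' = "D 1"])
      show "continuous_on {0..x} u" by (rule continuous_on_subset[OF cont]) (use that bT in auto)
      fix t assume t: "0 < t" "t < x"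
      have "at t within {0<..T} = at t"
        by (rule at_within_interior, rule interiorI[of "{0<..<T}"]) (use t that bT in auto)
      then show "(u has_real_derivative D 1 t) (at t)"
        using der[of 0 t] t that bT by (simp add: D0)
      show "\<bar>D 1 t\<bar> \<le> M * t powr (\<alpha> - 1)" using DB[of 1 t] t that bT by simp
    qed (use that \<alpha> in auto)
    have e: "a = 0" "b = \<tau>" "m = \<tau> / 2" using True by (auto simp: a_def b_def m_def)
    have 1: "\<bar>u \<tau> - u 0\<bar> \<le> M / \<alpha> * \<tau> powr \<alpha>" using inc[of \<tau>] \<tau> e by simp
    have "\<bar>u (\<tau>/2) - u 0\<bar> \<le> M / \<alpha> * (\<tau>/2) powr \<alpha>" using inc[of "\<tau>/2"] \<tau> e by simp
    also have "\<dots> \<le> M / \<alpha> * \<tau> powr \<alpha>" using \<tau> \<alpha> M by (intro mult_left_mono powr_mono2) auto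
    finally have 2: "\<bar>u (\<tau>/2) - u 0\<bar> \<le> M / \<alpha> * \<tau> powr \<alpha>" .
    have "\<bar>D 1 (\<tau>/2)\<bar> \<le> M * (\<tau>/2) powr (\<alpha> - 1)" using DB[of 1 "\<tau>/2"] \<tau> bT e by simp
    also have "\<dots> \<le> M * (2 powr (- (\<alpha> - 1)) * \<tau> powr (\<alpha> - 1))"
      by (intro mult_left_mono powr_neg_half_le) (use \<tau> \<alpha> M in auto)
    also have "\<dots> \<le> M * (2 * \<tau> powr (\<alpha> - 1))"
      using powr_mono[of "- (\<alpha> - 1)" 1 "2::real"] \<alpha> M by (intro mult_left_mono mult_right_mono) auto
    finally have "\<tau> * \<bar>D 1 (\<tau>/2)\<bar> \<le> \<tau> * (M * (2 * \<tau> powr (\<alpha> - 1)))"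
      using \<tau> by (intro mult_left_mono) auto
    also have "\<dots> = 2 * M * \<tau> powr \<alpha>"
      using \<tau> by (simp add: powr_diff)
    finally have 3: "\<bar>\<tau> * D 1 (\<tau>/2)\<bar> \<le> 2 * M * \<tau> powr \<alpha>" using \<tau> by (simp add: abs_mult)
    \<comment> \<open>\<open>X\<close> bounds an increment of \<open>u\<close> over the cell and
      \<open>2 * Y\<close> the slope term. The slope defect is at most \<open>X + 2 * Y\<close> and
      the averaging defect at most \<open>3/2 * X\<close>, both below
      \<open>8 * Y + 2 * X\<close>.\<close>
    define X Y where "X = M / \<alpha> * \<tau> powr \<alpha>" and "Y = M * \<tau> powr \<alpha>"
    have XY: "X \<ge> 0" "Y \<ge> 0" using M \<alpha> by (auto simp: X_def Y_def)
    have r: "M * (8 + 2 / \<alpha>) * (\<tau> powr \<alpha> * 1) = 8 * Y + 2 * X"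
      by (simp add: X_def Y_def algebra_simps)
    have 3: "\<bar>\<tau> * D 1 (\<tau>/2)\<bar> \<le> 2 * Y" using 3 by (simp add: Y_def)
    show ?thesis
      unfolding e True of_nat_1 powr_one_eq_one r
      using 1[folded X_def] 2[folded X_def] 3 XY unfolding abs_le_iff by (auto simp: field_simps)
  next
    case False
    then have j2: "2 \<le> j" using j by simp
    then have a0: "0 < a" using \<tau> by (simp add: a_def)
    have b2a: "b \<le> 2 * a"
      using j2 \<tau> mult_right_mono[of 2 "real j" \<tau>] by (simp add: a_def b_def algebra_simps)
    have sub: "{a..b} \<subseteq> {0<..T}" using a0 bT by auto
    have der': "(D k has_real_derivative D (Suc k) x) (at x within {a..b})"
      if "k < 3" "x \<in> {a..b}" for k x
      using has_field_derivative_subset[OF der sub] that sub by blast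
    have DB': "\<bar>D k x\<bar> \<le> M * 8 * b powr (\<alpha> - real k)"
      if k: "k \<in> {2,3}" and x: "x \<in> {a..b}" for k x
    proof -
      have "\<bar>D k x\<bar> \<le> M * x powr (\<alpha> - real k)" using DB k x sub by blast
      also have "\<dots> \<le> M * (2 powr (- (\<alpha> - real k)) * b powr (\<alpha> - real k))"
        by (intro mult_left_mono powr_neg_half_le) (use bT b2a x k \<alpha> M in auto)
      \<comment> \<open>The constant 8 is \<open>2 powr 3\<close>, which dominates
        \<open>2 powr (k - \<alpha>)\<close> for \<open>k\<close> equal to 2 or 3.\<close>
      also have "\<dots> \<le> M * (8 * b powr (\<alpha> - real k))"
        using powr_mono[of "- (\<alpha> - real k)" 3 "2::real"] k \<alpha> M
        by (intro mult_left_mono mult_right_mono) auto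
      finally show ?thesis by simp
    qed
    \<comment> \<open>Since \<open>b\<close> is \<open>j * \<tau>\<close>, the powers of the step
      size combine to \<open>\<tau> powr \<alpha>\<close> for every \<open>k\<close>, leaving only a
      power of the index.\<close>
    have scale: "b powr (\<alpha> - real k) * \<tau> ^ k = ?P (\<alpha> - real k)" for k
      using \<tau> j by (simp add: b_def powr_mult powr_diff powr_realpow)
    have "\<bar>u b - u a - (b - a) * D 1 ((a + b) / 2)\<bar> \<le> (M * 8 * b powr (\<alpha> - real 3)) * (b - a) ^ 3"
      by (rule midpoint_slope_error[where u'' = "D 2" and u''' = "D 3"])
        (use ab der'[of 0] der'[of 1] der'[of 2] DB'[of 3] in \<open>auto simp: D0 numeral_2_eq_2 numeral_3_eq_3\<close>)
    then have 1: "\<bar>u b - u a - \<tau> * D 1 m\<bar> \<le> M * 8 * ?P (\<alpha> - 3)"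
      using scale[of 3] by (simp add: ab mult.assoc)
    have "\<bar>(u a + u b) / 2 - u ((a + b) / 2)\<bar> \<le> (M * 8 * b powr (\<alpha> - real 2)) * (b - a)\<^sup>2"
      by (rule midpoint_average_error[where u' = "D 1" and u'' = "D 2"])
        (use ab der'[of 0] der'[of 1] DB'[of 2] in \<open>auto simp: D0 numeral_2_eq_2\<close>)
    then have 2: "\<bar>(u a + u b) / 2 - u m\<bar> \<le> M * 8 * ?P (\<alpha> - 2)"
      using scale[of 2] by (simp add: ab mult.assoc)
    have "M * 8 * ?P p \<le> M * (8 + 2 / \<alpha>) * ?P p" for p
      using M \<alpha> by (intro mult_right_mono mult_left_mono) auto
    with 1 2 show ?thesis by (meson order_trans)
  qed
  then have 1: "\<bar>u b - u a - \<tau> * D 1 m\<bar> \<le> M * (8 + 2 / \<alpha>) * ?P (\<alpha> - 3)"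
    and 2: "\<bar>(u a + u b) / 2 - u m\<bar> \<le> M * (8 + 2 / \<alpha>) * ?P (\<alpha> - 2)" by auto
  have "\<bar>z * ((u a + u b) / 2 - u m)\<bar> \<le> z * (M * (8 + 2 / \<alpha>) * ?P (\<alpha> - 2))"
    using mult_left_mono[OF 2, of z] z by (simp add: abs_mult)
  with 1 have "\<bar>(u b - u a - \<tau> * D 1 m) + z * ((u a + u b) / 2 - u m)\<bar>
      \<le> M * (8 + 2 / \<alpha>) * ?P (\<alpha> - 3) + z * (M * (8 + 2 / \<alpha>) * ?P (\<alpha> - 2))"
    by linarith
  also have "\<dots> = M * (8 + 2 / \<alpha>) * \<tau> powr \<alpha> * (real j powr (\<alpha> - 3) + z * real j powr (\<alpha> - 2))"
    by (simp add: distrib_left mult_ac)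
  finally show ?thesis using M unfolding z_def D_def by simp
qed

section \<open>Error propagation and the damped convolution sum\<close>

text \<open>Discrete variation of constants: a defect made at step \<open>j\<close> is damped by the
  remaining \<open>n - j\<close> steps.\<close>

lemma linear_recurrence_bound:
  fixes x d :: "nat \<Rightarrow> real"
  assumes "q \<ge> 0" "\<And>j. j \<in> {1..n} \<Longrightarrow> x j \<le> q * x (j - 1) + d j"
  shows "x n \<le> q ^ n * x 0 + (\<Sum>j=1..n. q ^ (n - j) * d j)"
  using assms(2)
proof (induction n)
  case (Suc n)
  have "x (Suc n) \<le> q * x n + d (Suc n)" using Suc.prems[of "Suc n"] by simp
  also have "\<dots> \<le> q * (q ^ n * x 0 + (\<Sum>j=1..n. q ^ (n - j) * d j)) + d (Suc n)"
    using Suc assms(1) by (intro add_right_mono mult_left_mono) auto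
  also have "\<dots> = q ^ Suc n * x 0 + q * (\<Sum>j=1..n. q ^ (n - j) * d j) + d (Suc n)"
    by (simp add: distrib_left mult.assoc)
  also have "q * (\<Sum>j=1..n. q ^ (n - j) * d j) = (\<Sum>j=1..n. q ^ (Suc n - j) * d j)"
    unfolding sum_distrib_left by (intro sum.cong) (auto simp: Suc_diff_le)
  finally show ?case by simp
qed auto

text \<open>After clearing denominators the difference \<open>f\<close> vanishes at 0 and is
  nonincreasing, because \<open>1 - x \<le> exp (- x)\<close>. Passing to the exponential makes the
  \<open>n\<close>-th power of the factor exactly \<open>exp (\<kappa> * t n)\<close> in the
  application.\<close>

lemma crank_nicolson_factor_le_exp:
  assumes "0 \<le> (z::real)" "z < 1"
  shows "(1 - z/2) / (1 + z/2) \<le> exp (- z)"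
proof -
  define f where "f = (\<lambda>z::real. (1 - z/2) * exp z - (1 + z/2))"
  have "f z \<le> f 0"
  proof (rule DERIV_nonpos_imp_nonincreasing[OF assms(1)])
    fix x :: real assume x: "0 \<le> x" "x \<le> z"
    have "(f has_real_derivative ((1 - x) * exp x - 1) / 2) (at x)"
      unfolding f_def by (auto intro!: derivative_eq_intros simp: field_simps)
    moreover have "(1 - x) * exp x \<le> 1"
      using exp_ge_add_one_self[of "- x"] by (simp add: exp_minus field_simps)
    ultimately show "\<exists>y. (f has_real_derivative y) (at x) \<and> y \<le> 0"
      by (intro exI[of _ "((1 - x) * exp x - 1) / 2"]) auto
  qed
  then show ?thesis using assms by (simp add: f_def exp_minus field_simps)
qed

text \<open>The first bound ignores the damping altogether and is meant for the regime in which
  \<open>exp (- z * n / 2)\<close> is not small; the second keeps the damping. \<open>K\<close> is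
  finite because \<alpha> - 2 < -1, and its term at index 0 is harmless since
  \<open>0 powr (\<alpha> - 2)\<close> is 0.\<close>

lemma damped_sum_bounds:
  fixes z \<alpha> :: real and n :: nat
  assumes \<alpha>: "0 < \<alpha>" "\<alpha> < 1" and z: "0 < z" "z < 1" and n: "n \<ge> 1"
  defines "S \<equiv> (\<Sum>j=1..n. exp (- z) ^ (n - j) * (real j powr (\<alpha> - 3) + z * real j powr (\<alpha> - 2)))"
    and "K \<equiv> 2 * (\<Sum>j. real j powr (\<alpha> - 2))"
  shows "S \<le> K" and "S \<le> K * exp (- z * n / 2) + 16 * real n powr (\<alpha> - 2)"
proof -
  let ?q = "exp (- z)"
  have summ: "summable (\<lambda>j. real j powr (\<alpha> - 2))" using \<alpha> by (simp add: summable_real_powr_iff)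
  have part: "(\<Sum>j=1..n. 2 * real j powr (\<alpha> - 2)) \<le> K"
    unfolding K_def sum_distrib_left[symmetric]
    by (intro mult_left_mono sum_le_suminf[OF summ]) auto
  have term_le: "real j powr (\<alpha> - 3) + z * real j powr (\<alpha> - 2) \<le> 2 * real j powr (\<alpha> - 2)"
    if "j \<ge> 1" for j
  proof -
    have "real j powr (\<alpha> - 3) \<le> real j powr (\<alpha> - 2)" using that by (intro powr_mono) auto
    moreover have "z * real j powr (\<alpha> - 2) \<le> 1 * real j powr (\<alpha> - 2)"
      using z by (intro mult_right_mono) auto
    ultimately show ?thesis by linarith
  qed
  have nonneg: "0 \<le> real j powr (\<alpha> - 3) + z * real j powr (\<alpha> - 2)" for j using z by simp
  have "S \<le> (\<Sum>j=1..n. 2 * real j powr (\<alpha> - 2))" unfolding S_def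
  proof (rule sum_mono)
    fix j assume "j \<in> {1..n}"
    then show "?q ^ (n - j) * (real j powr (\<alpha> - 3) + z * real j powr (\<alpha> - 2)) \<le> 2 * real j powr (\<alpha> - 2)"
      using mult_right_mono[OF _ nonneg[of j], of "?q ^ (n - j)" 1] term_le[of j] z
      by (simp add: power_le_one)
  qed
  with part show "S \<le> K" by linarith
  let ?h = "exp (- z * n / 2)"
  \<comment> \<open>Each term is bounded by the sum of the early-index and the late-index estimate,
    although only one of them is used for a given \<open>j\<close>. Both can then be summed over all
    of \<open>{1..n}\<close> without cutting the index range.\<close>
  have split: "?q ^ (n - j) * (real j powr (\<alpha> - 3) + z * real j powr (\<alpha> - 2))
      \<le> ?h * (2 * real j powr (\<alpha> - 2))
        + (8 * real n powr (\<alpha> - 3) + 4 * real n powr (\<alpha> - 2) * (z * ?q ^ (n - j)))"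
    if j: "j \<in> {1..n}" for j
  proof (cases "2 * j \<le> n")
    case True
    then have jn: "real n / 2 \<le> real (n - j)" by (simp add: of_nat_diff)
    have "?q ^ (n - j) = exp (- (z * real (n - j)))"
      by (simp add: exp_of_nat_mult[symmetric] mult.commute)
    also have "\<dots> \<le> ?h" using mult_left_mono[OF jn, of z] z by simp
    finally have "?q ^ (n - j) * (real j powr (\<alpha> - 3) + z * real j powr (\<alpha> - 2))
        \<le> ?h * (2 * real j powr (\<alpha> - 2))"
      using term_le[of j] nonneg[of j] j by (intro mult_mono) auto
    then show ?thesis using z by (intro add_increasing2) auto
  next
    case False
    \<comment> \<open>For \<open>j\<close> beyond \<open>n / 2\<close> the loss is at most
      \<open>2 powr k\<close>, which is the origin of the factors 8 and 4.\<close>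
    have p: "real j powr (\<alpha> - k) \<le> 2 powr k * real n powr (\<alpha> - k)" if "k \<ge> 2" for k
    proof -
      have "real j powr (\<alpha> - k) \<le> 2 powr (- (\<alpha> - k)) * real n powr (\<alpha> - k)"
        by (rule powr_neg_half_le) (use n False that \<alpha> in auto)
      also have "\<dots> \<le> 2 powr k * real n powr (\<alpha> - k)"
        using \<alpha> by (intro mult_right_mono powr_mono) auto
      finally show ?thesis .
    qed
    have p3: "real j powr (\<alpha> - 3) \<le> 8 * real n powr (\<alpha> - 3)" using p[of 3] by simp
    have p2: "real j powr (\<alpha> - 2) \<le> 4 * real n powr (\<alpha> - 2)" using p[of 2] by simp
    have "?q ^ (n - j) * real j powr (\<alpha> - 3) \<le> 1 * (8 * real n powr (\<alpha> - 3))"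
      using p3 z by (intro mult_mono power_le_one) auto
    moreover have "(z * ?q ^ (n - j)) * real j powr (\<alpha> - 2)
        \<le> (z * ?q ^ (n - j)) * (4 * real n powr (\<alpha> - 2))"
      using p2 z by (intro mult_left_mono) auto
    ultimately have "?q ^ (n - j) * (real j powr (\<alpha> - 3) + z * real j powr (\<alpha> - 2))
        \<le> 8 * real n powr (\<alpha> - 3) + 4 * real n powr (\<alpha> - 2) * (z * ?q ^ (n - j))"
      by (simp add: algebra_simps)
    then show ?thesis by (rule add_increasing[rotated]) simp
  qed
  \<comment> \<open>The geometric series contributes at most \<open>1 / (1 - exp (- z))\<close>, and
    \<open>z \<le> 2 * (1 - exp (- z))\<close> for \<open>z\<close> below 1, so the total stays
    bounded as \<open>z\<close> tends to 0.\<close>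
  have geom: "(\<Sum>j=1..n. z * ?q ^ (n - j)) \<le> 2"
  proof -
    have "(\<Sum>j=1..n. ?q ^ (n - j)) = (\<Sum>i<n. ?q ^ i)"
      by (rule sum.reindex_bij_witness[of _ "\<lambda>i. n - i" "\<lambda>j. n - j"]) auto
    then have g: "(1 - ?q) * (\<Sum>j=1..n. ?q ^ (n - j)) = 1 - ?q ^ n"
      by (simp add: one_diff_power_eq)
    have "?q \<le> 1 / (1 + z)"
      using exp_ge_add_one_self[of z] z by (simp add: exp_minus field_simps)
    also have "\<dots> \<le> 1 - z / 2"
      using z mult_strict_left_mono[of z 1 z] by (simp add: field_simps)
    finally have "z \<le> 2 * (1 - ?q)" by simp
    then have "z * (\<Sum>j=1..n. ?q ^ (n - j)) \<le> 2 * (1 - ?q) * (\<Sum>j=1..n. ?q ^ (n - j))"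
      by (intro mult_right_mono sum_nonneg) auto
    also have "\<dots> = 2 * (1 - ?q ^ n)" unfolding mult.assoc g ..
    also have "\<dots> \<le> 2" by simp
    finally show ?thesis by (simp add: sum_distrib_left[symmetric])
  qed
  have "S \<le> (\<Sum>j=1..n. ?h * (2 * real j powr (\<alpha> - 2))
        + (8 * real n powr (\<alpha> - 3) + 4 * real n powr (\<alpha> - 2) * (z * ?q ^ (n - j))))"
    unfolding S_def by (intro sum_mono split)
  also have "\<dots> = ?h * (\<Sum>j=1..n. 2 * real j powr (\<alpha> - 2)) + real n * (8 * real n powr (\<alpha> - 3))
      + 4 * real n powr (\<alpha> - 2) * (\<Sum>j=1..n. z * ?q ^ (n - j))"
    by (simp add: sum.distrib sum_distrib_left)
  \<comment> \<open>The 16 of the claim is 8 from these \<open>n\<close> equal terms plus 4 times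
    the geometric bound 2.\<close>
  also have "real n * (8 * real n powr (\<alpha> - 3)) = 8 * real n powr (\<alpha> - 2)"
    using n by (simp add: powr_diff field_simps power2_eq_square power3_eq_cube)
  finally have "S \<le> ?h * (\<Sum>j=1..n. 2 * real j powr (\<alpha> - 2)) + 8 * real n powr (\<alpha> - 2)
      + 4 * real n powr (\<alpha> - 2) * (\<Sum>j=1..n. z * ?q ^ (n - j))" .
  moreover have "?h * (\<Sum>j=1..n. 2 * real j powr (\<alpha> - 2)) \<le> ?h * K"
    using part by (intro mult_left_mono) auto
  moreover have "4 * real n powr (\<alpha> - 2) * (\<Sum>j=1..n. z * ?q ^ (n - j))
      \<le> 4 * real n powr (\<alpha> - 2) * 2"
    using geom by (intro mult_left_mono) auto
  ultimately have "S \<le> ?h * K + 16 * real n powr (\<alpha> - 2)" by linarith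
  then show "S \<le> K * ?h + 16 * real n powr (\<alpha> - 2)" by (simp only: mult.commute)
qed

section \<open>Absorbing the sum into \<open>C3\<close> and \<open>C4\<close>\<close>

text \<open>Since \<kappa> is negative, the threshold on \<open>t\<close> is the condition
  \<open>E < 1 - 1 / P\<close>, and the formula for \<open>C4\<close> vanishes exactly where
  equality holds; hence it is nonnegative on its branch. If \<open>E\<close> is below 1/4,
  \<open>P \<ge> 2\<close> gives \<open>C4\<close> at least \<open>1/2 * (2 * 3/4 - 1)\<close>;
  otherwise \<open>exp (\<kappa> * t / 2)\<close> dominates \<open>E\<close>, because 1/2 <
  7/12.\<close>

lemma C4_dichotomy:
  assumes "0 < \<alpha>" "\<alpha> < 1" "\<kappa> < 0" "t \<ge> 0"
  shows "C4 \<alpha> \<kappa> t \<ge> 0" and "C4 \<alpha> \<kappa> t \<ge> 1/4 \<or> exp (\<kappa> * t / 2) \<ge> 1/4"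
proof -
  define P where "P = (2::real) powr (2 - \<alpha>)"
  define E where "E = exp (7 * \<kappa> * t / 12)"
  have P: "P \<ge> 2" using powr_mono[of 1 "2 - \<alpha>" "2::real"] assms by (simp add: P_def)
  have Pinv: "2 powr (\<alpha> - 2) = 1 / P"
    using powr_minus[of "2::real" "2 - \<alpha>"] by (simp add: P_def field_simps)
  have pos: "1 - 1 / P > 0" using P by (simp add: field_simps)
  have "t > 12 / (7 * \<kappa>) * ln (1 - 1 / P) \<longleftrightarrow> 7 * \<kappa> * t / 12 < ln (1 - 1 / P)"
    using \<open>\<kappa> < 0\<close> by (simp add: field_simps)
  also have "\<dots> \<longleftrightarrow> E < 1 - 1 / P"
    unfolding E_def using exp_less_cancel_iff[of _ "ln (1 - 1 / P)"] pos by simp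
  finally have C4: "C4 \<alpha> \<kappa> t = (if E < 1 - 1 / P then 1 / (2 - \<alpha>) * (P * (1 - E) - 1) else 0)"
    unfolding C4_def Pinv by (simp add: P_def E_def)
  have ge: "P * (1 - E) - 1 \<ge> 0" if "E < 1 - 1 / P"
    using mult_strict_left_mono[OF that, of P] P by (simp add: algebra_simps)
  show "C4 \<alpha> \<kappa> t \<ge> 0" using ge assms unfolding C4 by auto
  show "C4 \<alpha> \<kappa> t \<ge> 1/4 \<or> exp (\<kappa> * t / 2) \<ge> 1/4"
  proof (cases "E < 1 / 4")
    case True
    have "1 / P \<le> 1 / 2" using P by (simp add: field_simps)
    then have lt: "E < 1 - 1 / P" using True by linarith
    have "P * (3/4) \<le> P * (1 - E)" using True P by (intro mult_left_mono) auto
    then have "1 / 2 \<le> P * (1 - E) - 1" using P by linarith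
    moreover have "1 / (2 - \<alpha>) \<ge> 1 / 2" using assms by (intro divide_left_mono) auto
    ultimately have "1 / (2 - \<alpha>) * (P * (1 - E) - 1) \<ge> 1 / 2 * (1 / 2)"
      using assms by (intro mult_mono) auto
    then show ?thesis using lt unfolding C4 by simp
  next
    case False
    have "\<kappa> * t \<le> 0" using assms by (simp add: mult_nonpos_nonneg)
    then have "E \<le> exp (\<kappa> * t / 2)" by (simp add: E_def)
    then show ?thesis using False by linarith
  qed
qed

text \<open>The damped bound on the sum is used when \<open>C4\<close> is at least 1/4, and the
  undamped one when \<open>h\<close> is at least 1/4. The constant 64 is 16 times 4, the price of
  replacing \<open>Q\<close> by \<open>4 * C4 * Q\<close>.\<close>

lemma damped_sum_le_C3_C4:
  fixes z \<alpha> :: real and n :: nat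
  assumes \<alpha>: "0 < \<alpha>" "\<alpha> < 1" and z: "0 < z" "z < 1" and n: "n \<ge> 1" and \<kappa>: "\<kappa> < 0"
    and t: "\<kappa> * t = - z * n"
  shows "(\<Sum>j=1..n. exp (- z) ^ (n - j) * (real j powr (\<alpha> - 3) + z * real j powr (\<alpha> - 2)))
    \<le> (64 + 2 * (\<Sum>j. real j powr (\<alpha> - 2)))
       * (C3 \<alpha> \<kappa> t * exp (\<kappa> * t / 2) + C4 \<alpha> \<kappa> t * real n powr (\<alpha> - 2))"
    (is "?S \<le> _")
proof -
  define K where "K = 2 * (\<Sum>j. real j powr (\<alpha> - 2))"
  define h where "h = exp (\<kappa> * t / 2)"
  define Q where "Q = real n powr (\<alpha> - 2)"
  have t0: "t \<ge> 0"
  proof -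
    have "\<kappa> * t < 0" using z n by (simp add: t)
    then show ?thesis using \<kappa> by (simp add: mult_less_0_iff)
  qed
  have S: "?S \<le> K" "?S \<le> K * h + 16 * Q"
    using damped_sum_bounds[OF \<alpha> z n] by (simp_all add: K_def h_def Q_def t)
  have K: "K \<ge> 0" unfolding K_def using \<alpha>
    by (intro mult_nonneg_nonneg suminf_nonneg) (auto simp: summable_real_powr_iff)
  have h: "h > 0" and Q: "Q \<ge> 0" by (auto simp: h_def Q_def)
  \<comment> \<open>A lower bound of 4 on \<open>C3\<close> is what makes \<open>C3 * h\<close> at
    least 1 as soon as \<open>h\<close> reaches 1/4.\<close>
  have "9 / (2 - \<alpha>) \<ge> 9 / 2" using \<alpha> by (intro divide_left_mono) auto
  then have C3: "C3 \<alpha> \<kappa> t \<ge> 4" using h unfolding C3_def h_def[symmetric] by linarith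
  note C4 = C4_dichotomy[OF \<alpha> \<kappa> t0, folded h_def]
  have C3h: "4 * h \<le> C3 \<alpha> \<kappa> t * h" using C3 h by (intro mult_right_mono) auto
  have C4Q: "0 \<le> C4 \<alpha> \<kappa> t * Q" using C4(1) Q by simp
  have "?S \<le> K * (C3 \<alpha> \<kappa> t * h) + 64 * (C4 \<alpha> \<kappa> t * Q)"
    using C4(2)
  proof
    assume "1/4 \<le> C4 \<alpha> \<kappa> t"
    then have "1/4 * Q \<le> C4 \<alpha> \<kappa> t * Q" using Q by (intro mult_right_mono) auto
    moreover have "K * h \<le> K * (C3 \<alpha> \<kappa> t * h)" using C3h h K by (intro mult_left_mono) auto
    ultimately show ?thesis using S(2) by linarith
  next
    assume "1/4 \<le> h"
    then have "1 \<le> C3 \<alpha> \<kappa> t * h" using C3h by linarith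
    then have "K * 1 \<le> K * (C3 \<alpha> \<kappa> t * h)" using K by (intro mult_left_mono) auto
    then show ?thesis using S(1) C4Q by linarith
  qed
  also have "\<dots> \<le> (64 + K) * (C3 \<alpha> \<kappa> t * h + C4 \<alpha> \<kappa> t * Q)"
    using K C4Q C3h h by (simp add: algebra_simps)
  finally show ?thesis by (simp add: K_def h_def Q_def)
qed

section \<open>Assembly of the global error estimate\<close>

theorem theorem2p2:
  fixes \<alpha> M :: real
  assumes "0 < \<alpha>" and "\<alpha> < 1"
  shows "\<exists>C>0. \<forall>(\<kappa>::real) (T::real) (N::nat) (\<tau>::real) (u::real \<Rightarrow> real) (f::real \<Rightarrow> real)
           (u0::real) (U::nat \<Rightarrow> real) (t::nat \<Rightarrow> real) (e::nat \<Rightarrow> real).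
           \<kappa> < 0 \<longrightarrow> T > 0 \<longrightarrow> N \<ge> 1 \<longrightarrow> \<tau> = T / real N \<longrightarrow> (\<forall>n. t n = real n * \<tau>) \<longrightarrow>
           solves_ivp \<kappa> f u0 T u \<longrightarrow> weakly_singular_bound \<alpha> M T u \<longrightarrow>
           crank_nicolson \<kappa> f u0 \<tau> N U \<longrightarrow> (\<forall>n. e n = u (t n) - U n) \<longrightarrow>
           0 < - \<kappa> * \<tau> \<longrightarrow> - \<kappa> * \<tau> < 1 \<longrightarrow>
           (\<forall>n\<in>{1..N}.
              \<bar>e n\<bar> \<le> exp (\<kappa> * t n) * \<bar>e 0\<bar>
                + C * (C3 \<alpha> \<kappa> (t n) * exp (\<kappa> * t n / 2) * \<tau> powr \<alpha>
                       + C4 \<alpha> \<kappa> (t n) * t n powr (\<alpha> - 2) * \<tau>\<^sup>2))"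
proof -
  define K where "K = 64 + 2 * (\<Sum>j. real j powr (\<alpha> - 2))"
  have K: "K > 0" unfolding K_def using assms
    by (intro add_pos_nonneg mult_nonneg_nonneg suminf_nonneg) (auto simp: summable_real_powr_iff)
  \<comment> \<open>Together with \<open>K\<close> this fixes the final constant from \<alpha> and
    \<open>M\<close> alone, before any problem data are introduced. The form
    \<open>\<bar>M\<bar> + 1\<close> keeps it positive for every real \<open>M\<close>.\<close>
  define A where "A = (\<bar>M\<bar> + 1) * (8 + 2 / \<alpha>)"
  have A: "A > 0" using assms by (auto simp: A_def intro!: mult_pos_pos add_nonneg_pos)
  show ?thesis
  proof (intro exI[of _ "A * K"] conjI allI impI ballI)
    show "0 < A * K" using A K by simp
    fix \<kappa> T :: real and N :: nat and \<tau> :: real and u f :: "real \<Rightarrow> real" and u0 :: real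
      and U t e :: "nat \<Rightarrow> real" and n :: nat
    assume \<kappa>: "\<kappa> < 0" and T: "T > 0" and N: "N \<ge> 1" and \<tau>: "\<tau> = T / real N"
      and t: "\<forall>n. t n = real n * \<tau>" and ivp: "solves_ivp \<kappa> f u0 T u"
      and bound: "weakly_singular_bound \<alpha> M T u" and CN: "crank_nicolson \<kappa> f u0 \<tau> N U"
      and e: "\<forall>n. e n = u (t n) - U n" and z0: "0 < - \<kappa> * \<tau>" and z1: "- \<kappa> * \<tau> < 1"
      and n: "n \<in> {1..N}"
    define z where "z = - \<kappa> * \<tau>"
    have z: "0 < z" "z < 1" using z0 z1 by (auto simp: z_def)
    have \<tau>0: "\<tau> > 0" and N\<tau>: "real N * \<tau> = T" using T N by (auto simp: \<tau>)
    define a where "a = (\<lambda>j. real j powr (\<alpha> - 3) + z * real j powr (\<alpha> - 2))"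
    have step: "\<bar>e j\<bar> \<le> exp (- z) * \<bar>e (j - 1)\<bar> + A * \<tau> powr \<alpha> * a j" if j: "j \<in> {1..n}" for j
    proof -
      have jN: "j \<in> {1..N}" using j n by auto
      then have jT: "real j * \<tau> \<le> T"
        using \<tau>0 N\<tau> mult_right_mono[of "real j" "real N" \<tau>] by auto
      define m where "m = (real j - 1/2) * \<tau>"
      have m: "m \<in> {0<..T}"
      proof -
        have "m \<le> real j * \<tau>" using \<tau>0 by (simp add: m_def algebra_simps)
        moreover have "0 < m" using jN \<tau>0 by (auto simp: m_def)
        ultimately show ?thesis using jT by simp
      qed
      have tj: "t j = real j * \<tau>" "t (j - 1) = (real j - 1) * \<tau>"
        using t jN by (auto simp: of_nat_diff)
      \<comment> \<open>The local defect is arranged so that, by the differential equation at the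
        midpoint, \<open>f m\<close> cancels against the scheme and only a recurrence for
        \<open>e\<close> with source \<open>d\<close> remains.\<close>
      define d where "d = u (t j) - u (t (j - 1)) - \<tau> * deriv_on 1 {0<..T} u m
          - \<kappa> * \<tau> * ((u (t (j - 1)) + u (t j)) / 2 - u m)"
      have "\<bar>d\<bar> \<le> \<bar>M\<bar> * (8 + 2 / \<alpha>) * \<tau> powr \<alpha> * a j"
        unfolding d_def tj m_def a_def z_def
        by (rule local_defect_bound[OF assms \<tau>0 \<kappa> z1 _ jT _ _ bound])
          (use jN ivp in \<open>auto simp: solves_ivp_def\<close>)
      also have "\<dots> \<le> A * \<tau> powr \<alpha> * a j"
        unfolding A_def using z assms by (intro mult_right_mono) (auto simp: a_def)
      finally have d: "\<bar>d\<bar> \<le> A * \<tau> powr \<alpha> * a j" .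
      have ode: "deriv_on 1 {0<..T} u m = \<kappa> * u m + f m"
        using ivp m unfolding solves_ivp_def by blast
      have "(U j - U (j - 1)) / \<tau> = \<kappa> * ((U j + U (j - 1)) / 2) + f m"
        using CN jN unfolding crank_nicolson_def m_def by blast
      then have scheme: "U j - U (j - 1) = \<tau> * (\<kappa> * ((U j + U (j - 1)) / 2) + f m)"
        using \<tau>0 by (simp add: field_simps)
      have "(1 + z/2) * e j = (1 - z/2) * e (j - 1) + d"
        using scheme unfolding d_def ode z_def e[rule_format] by (simp add: field_simps)
      moreover have "1 + z/2 \<noteq> 0" using z by simp
      ultimately have "e j = ((1 - z/2) * e (j - 1) + d) / (1 + z/2)"
        by (metis nonzero_mult_div_cancel_left)
      then have "e j = (1 - z/2) / (1 + z/2) * e (j - 1) + d / (1 + z/2)"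
        by (simp add: add_divide_distrib)
      then have "\<bar>e j\<bar> \<le> \<bar>(1 - z/2) / (1 + z/2) * e (j - 1)\<bar> + \<bar>d / (1 + z/2)\<bar>"
        by (simp only: abs_triangle_ineq)
      also have "\<dots> = (1 - z/2) / (1 + z/2) * \<bar>e (j - 1)\<bar> + \<bar>d\<bar> / (1 + z/2)"
        using z by (simp add: abs_mult)
      \<comment> \<open>The denominator \<open>1 + z/2\<close> is at least 1, so it may be dropped
        from the defect term.\<close>
      also have "\<dots> \<le> exp (- z) * \<bar>e (j - 1)\<bar> + \<bar>d\<bar> / 1"
        using z crank_nicolson_factor_le_exp[of z]
        by (intro add_mono mult_right_mono divide_left_mono) auto
      finally show ?thesis using d by simp
    qed
    have \<kappa>t: "\<kappa> * t n = - z * n" using t by (simp add: z_def)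
    let ?R = "C3 \<alpha> \<kappa> (t n) * exp (\<kappa> * t n / 2) + C4 \<alpha> \<kappa> (t n) * real n powr (\<alpha> - 2)"
    have "\<bar>e n\<bar> \<le> exp (- z) ^ n * \<bar>e 0\<bar> + (\<Sum>j=1..n. exp (- z) ^ (n - j) * (A * \<tau> powr \<alpha> * a j))"
      by (rule linear_recurrence_bound[where x = "\<lambda>j. \<bar>e j\<bar>"]) (use step in auto)
    also have "exp (- z) ^ n = exp (\<kappa> * t n)"
      unfolding \<kappa>t by (simp add: exp_of_nat_mult[symmetric] mult.commute)
    also have "(\<Sum>j=1..n. exp (- z) ^ (n - j) * (A * \<tau> powr \<alpha> * a j))
        = A * \<tau> powr \<alpha> * (\<Sum>j=1..n. exp (- z) ^ (n - j) * a j)"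
      by (simp add: sum_distrib_left mult_ac)
    also have "\<dots> \<le> A * \<tau> powr \<alpha> * (K * ?R)"
      unfolding a_def K_def using n A
      by (intro mult_left_mono damped_sum_le_C3_C4[OF assms z _ \<kappa> \<kappa>t]) auto
    also have "\<dots> = A * K * (C3 \<alpha> \<kappa> (t n) * exp (\<kappa> * t n / 2) * \<tau> powr \<alpha>
        + C4 \<alpha> \<kappa> (t n) * (\<tau> powr \<alpha> * real n powr (\<alpha> - 2)))"
      by (simp add: algebra_simps)
    \<comment> \<open>Rescaling from the index \<open>n\<close> to the time
      \<open>n * \<tau>\<close> turns the missing \<alpha> - 2 powers of \<tau> into the factor
      \<tau> squared.\<close>
    also have "\<tau> powr \<alpha> * real n powr (\<alpha> - 2) = t n powr (\<alpha> - 2) * \<tau>\<^sup>2"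
      using t n \<tau>0 by (simp add: powr_mult powr_diff)
    finally show "\<bar>e n\<bar> \<le> exp (\<kappa> * t n) * \<bar>e 0\<bar>
        + A * K * (C3 \<alpha> \<kappa> (t n) * exp (\<kappa> * t n / 2) * \<tau> powr \<alpha>
                   + C4 \<alpha> \<kappa> (t n) * t n powr (\<alpha> - 2) * \<tau>\<^sup>2)"
      by (simp add: mult.assoc)
  qed
qed

end
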